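(* Let $H_1$ and $H_2$ be real Hilbert spaces, let $g:H_1\to\mathbb{R}\cup\{\infty\}$ be a proper, convex and lower semicontinuous function, let $L:H_1\to H_2$ be a bounded linear operator with adjoint $L^*:H_2\to H_1$, and let $\lambda>0$. If $L^*L:H_1\to H_1$ is surjective, then for every $c\in H_2$ the functional $$I(u)=g(u)+\frac{\lambda}{2}\|Lu+c\|^2,\qquad u\in H_1,$$ has a unique minimizer on $H_1$.
   Context: Hilbert spaces are identified with their duals, so that $L^*$ maps $H_2$ to $H_1$. The norm $\|\cdot\|$ is the norm of $H_2$. *)

theory Defs
  imports "HOL-Analysis.Analysis"
begin

text \<open>
  Functions with values in \<open>\<real> \<union> {\<infinity>}\<close> are rendered as \<^typ>\<open>ereal\<close>-valued functions; the value
  \<open>-\<infinity>\<close> is excluded by properness.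
\<close>

definition proper_fun :: "('a \<Rightarrow> ereal) \<Rightarrow> bool" where
  "proper_fun f \<longleftrightarrow> (\<forall>x. f x \<noteq> -\<infinity>) \<and> (\<exists>x. f x \<noteq> \<infinity>)"

text \<open>
  The weights range over the open interval, so the convention \<open>0 * \<infinity> = 0\<close> of \<^typ>\<open>ereal\<close> plays no role.
\<close>

definition convex_fun :: "('a::real_vector \<Rightarrow> ereal) \<Rightarrow> bool" where
  "convex_fun f \<longleftrightarrow>
     (\<forall>x y t. 0 < t \<and> t < 1 \<longrightarrow>
        f ((1 - t) *\<^sub>R x + t *\<^sub>R y) \<le> ereal (1 - t) * f x + ereal t * f y)"

definition lsc_fun :: "('a::topological_space \<Rightarrow> ereal) \<Rightarrow> bool" where
  "lsc_fun f \<longleftrightarrow> (\<forall>x. f x \<le> Liminf (at x) f)"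

end

theory Submission
  imports Defs
begin

text \<open>
  Surjectivity of \<open>L\<^sup>* L\<close> makes the quadratic term strongly convex, and a proper, lower semicontinuous,
  strongly convex function on a complete space has exactly one minimizer.

  For the first part, write any \<open>y\<close> as \<open>L\<^sup>* L v\<close>. Then \<open>\<langle>u, y\<rangle> = \<langle>L u, L v\<rangle>\<close>, so \<open>\<langle>u, y\<rangle>\<close> is bounded by
  \<open>\<parallel>L v\<parallel>\<close> on the set of all \<open>u\<close> with \<open>\<parallel>L u\<parallel> \<le> 1\<close>. That set is thus weakly bounded, hence bounded in norm
  by the Baire category theorem (\<open>weakly_bounded_imp_bounded\<close>), which after scaling says
  \<open>m \<parallel>u\<parallel> \<le> \<parallel>L u\<parallel>\<close> for some \<open>m > 0\<close> (\<open>surj_adjoint_comp_imp_bounded_below\<close>).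
  The parallelogram-type identity \<open>norm_convex_combination_sq\<close> turns this bound into strong convexity of
  \<open>\<alpha> \<parallel>L u + c\<parallel>\<^sup>2\<close>, and adding the convex function \<open>g\<close> preserves it.

  For the second part, a strongly convex function is bounded below: lower semicontinuity bounds it near
  one point of finite value, and strong convexity propagates the bound outwards
  (\<open>strongly_convex_bounded_below\<close>). Minimizing sequences are
  then Cauchy by strong convexity at midpoints, and lower semicontinuity makes their limit a minimizer
  (\<open>strongly_convex_unique_minimizer\<close>).

  The constant \<^const>\<open>adjoint\<close> is a choice among functions satisfying the adjoint identity, so the identity
  holds only if such a function exists. Existence follows from the Riesz representation theorem, which
  rests on a further instance of the minimization result, with a linear \<open>g\<close> and \<open>L\<close> the identity.
\<close>

section \<open>Lower semicontinuity and strong convexity\<close>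

text \<open>
  Only real levels \<open>a\<close> occur, so that real numbers can be added to and subtracted from them, and the
  neighbourhoods are full rather than punctured, so that the criterion applies to convergent sequences
  which may attain their limit.
\<close>

lemma lsc_fun_iff:
  fixes f :: "'a::topological_space \<Rightarrow> ereal"
  shows "lsc_fun f \<longleftrightarrow> (\<forall>x a. ereal a < f x \<longrightarrow> (\<forall>\<^sub>F y in nhds x. ereal a < f y))"
proof
  assume lsc: "lsc_fun f"
  show "\<forall>x a. ereal a < f x \<longrightarrow> (\<forall>\<^sub>F y in nhds x. ereal a < f y)"
  proof (intro allI impI)
    fix x a assume a: "ereal a < f x"
    then have "\<forall>\<^sub>F y in at x. ereal a < f y"
      using lsc unfolding lsc_fun_def le_Liminf_iff by blast
    then show "\<forall>\<^sub>F y in nhds x. ereal a < f y"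
      using a by (auto simp: eventually_at_filter elim!: eventually_mono)
  qed
next
  assume nbhd: "\<forall>x a. ereal a < f x \<longrightarrow> (\<forall>\<^sub>F y in nhds x. ereal a < f y)"
  show "lsc_fun f"
    unfolding lsc_fun_def le_Liminf_iff
  proof (intro allI impI)
    fix x y assume "y < f x"
    then obtain a where a: "y < ereal a" "ereal a < f x"
      using ereal_dense2 by blast
    then have "\<forall>\<^sub>F z in nhds x. ereal a < f z"
      using nbhd by blast
    then show "\<forall>\<^sub>F z in at x. y < f z"
      using a by (auto simp: eventually_at_filter elim!: eventually_mono)
  qed
qed

lemma lsc_fun_add_continuous:
  fixes g :: "'a::topological_space \<Rightarrow> ereal" and h :: "'a \<Rightarrow> real"
  assumes lsc: "lsc_fun g" and cont: "continuous_on UNIV h"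
  shows "lsc_fun (\<lambda>u. g u + ereal (h u))"
  unfolding lsc_fun_iff
proof (intro allI impI)
  fix x a assume "ereal a < g x + ereal (h x)"
  then have "ereal (a - h x) < g x"
    by (cases "g x") auto
  then obtain b where b: "ereal (a - h x) < ereal b" "ereal b < g x"
    using ereal_dense2 by blast
  have "\<forall>\<^sub>F y in nhds x. ereal b < g y"
    using lsc b unfolding lsc_fun_iff by blast
  moreover have "\<forall>\<^sub>F y in nhds x. a - b < h y"
    using cont b continuous_on_open_vimage[of UNIV h]
    by (intro eventually_nhds[THEN iffD2] exI[of _ "h -` {a - b<..}"])
      (auto intro: open_vimage)
  ultimately show "\<forall>\<^sub>F y in nhds x. ereal a < g y + ereal (h y)"
  proof eventually_elim
    case (elim y)
    then show ?case by (cases "g y") auto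
  qed
qed

definition strongly_convex_fun :: "real \<Rightarrow> ('a::real_normed_vector \<Rightarrow> ereal) \<Rightarrow> bool" where
  "strongly_convex_fun \<kappa> f \<longleftrightarrow>
     (\<forall>x y t. 0 < t \<and> t < 1 \<longrightarrow>
        f ((1 - t) *\<^sub>R x + t *\<^sub>R y) + ereal (\<kappa> * (t * (1 - t)) * (norm (x - y))\<^sup>2)
          \<le> ereal (1 - t) * f x + ereal t * f y)"

text \<open>
  Between two points of finite value, strong convexity becomes an inequality between real numbers.
\<close>

lemma strongly_convex_fun_finiteE:
  assumes "proper_fun f" "strongly_convex_fun \<kappa> f"
    and "f x = ereal a" "f y = ereal b" "0 < t" "t < 1"
  obtains c where "f ((1 - t) *\<^sub>R x + t *\<^sub>R y) = ereal c"
    and "c + \<kappa> * (t * (1 - t)) * (norm (x - y))\<^sup>2 \<le> (1 - t) * a + t * b"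
proof -
  let ?z = "(1 - t) *\<^sub>R x + t *\<^sub>R y"
  have "f ?z + ereal (\<kappa> * (t * (1 - t)) * (norm (x - y))\<^sup>2)
      \<le> ereal (1 - t) * f x + ereal t * f y"
    using assms unfolding strongly_convex_fun_def by blast
  moreover have "f ?z \<noteq> -\<infinity>"
    using assms unfolding proper_fun_def by blast
  ultimately show thesis
    using that assms by (cases "f ?z") auto
qed

lemma strongly_convex_fun_add:
  fixes g :: "'a::real_normed_vector \<Rightarrow> ereal"
  assumes g: "convex_fun g" "\<And>x. g x \<noteq> -\<infinity>"
    and h: "strongly_convex_fun \<kappa> (\<lambda>u. ereal (h u))"
  shows "strongly_convex_fun \<kappa> (\<lambda>u. g u + ereal (h u))"
  unfolding strongly_convex_fun_def
proof (intro allI impI)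
  fix x y :: 'a and t :: real assume t: "0 < t \<and> t < 1"
  let ?z = "(1 - t) *\<^sub>R x + t *\<^sub>R y"
  have "g ?z \<le> ereal (1 - t) * g x + ereal t * g y"
    using g t unfolding convex_fun_def by blast
  moreover have "h ?z + \<kappa> * (t * (1 - t)) * (norm (x - y))\<^sup>2 \<le> (1 - t) * h x + t * h y"
    using h t unfolding strongly_convex_fun_def by fastforce
  ultimately show "g ?z + ereal (h ?z) + ereal (\<kappa> * (t * (1 - t)) * (norm (x - y))\<^sup>2)
      \<le> ereal (1 - t) * (g x + ereal (h x)) + ereal t * (g y + ereal (h y))"
    using g(2)[of x] g(2)[of y] g(2)[of ?z] t
    by (cases "g x"; cases "g y"; cases "g ?z") (auto simp: algebra_simps)
qed

text \<open>
  At \<open>t = 1/2\<close> this is the parallelogram law.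
\<close>

lemma norm_convex_combination_sq:
  fixes a b :: "'a::real_inner"
  shows "(norm ((1 - t) *\<^sub>R a + t *\<^sub>R b))\<^sup>2 + t * (1 - t) * (norm (a - b))\<^sup>2
    = (1 - t) * (norm a)\<^sup>2 + t * (norm b)\<^sup>2"
  unfolding power2_norm_eq_inner
  by (simp add: algebra_simps inner_commute power2_eq_square)

lemma strongly_convex_affine_norm_sq:
  fixes L :: "'a::real_normed_vector \<Rightarrow> 'b::real_inner"
  assumes lin: "linear L" and below: "\<And>u. m * norm u \<le> norm (L u)"
    and "0 \<le> m" "0 \<le> \<alpha>"
  shows "strongly_convex_fun (\<alpha> * m\<^sup>2) (\<lambda>u. ereal (\<alpha> * (norm (L u + c))\<^sup>2))"
  unfolding strongly_convex_fun_def
proof (intro allI impI)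
  fix x y :: 'a and t :: real assume t: "0 < t \<and> t < 1"
  let ?z = "(1 - t) *\<^sub>R x + t *\<^sub>R y"
  let ?a = "L x + c" and ?b = "L y + c"
  have z: "L ?z + c = (1 - t) *\<^sub>R ?a + t *\<^sub>R ?b"
    unfolding linear_add[OF lin] linear_scale[OF lin] by (simp add: algebra_simps)
  have "(m * norm (x - y))\<^sup>2 \<le> (norm (L (x - y)))\<^sup>2"
    using below[of "x - y"] \<open>0 \<le> m\<close> by (intro power_mono) auto
  also have "L (x - y) = ?a - ?b"
    using lin by (simp add: linear_diff)
  finally have "\<alpha> * (t * (1 - t)) * (m * norm (x - y))\<^sup>2 \<le> \<alpha> * (t * (1 - t)) * (norm (?a - ?b))\<^sup>2"
    using t \<open>0 \<le> \<alpha>\<close> by (intro mult_left_mono) auto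
  moreover have "\<alpha> * ((norm (L ?z + c))\<^sup>2 + t * (1 - t) * (norm (?a - ?b))\<^sup>2)
      = \<alpha> * ((1 - t) * (norm ?a)\<^sup>2 + t * (norm ?b)\<^sup>2)"
    unfolding z norm_convex_combination_sq ..
  ultimately have "\<alpha> * (norm (L ?z + c))\<^sup>2 + \<alpha> * m\<^sup>2 * (t * (1 - t)) * (norm (x - y))\<^sup>2
      \<le> (1 - t) * (\<alpha> * (norm ?a)\<^sup>2) + t * (\<alpha> * (norm ?b)\<^sup>2)"
    by (simp add: algebra_simps power_mult_distrib)
  then show "ereal (\<alpha> * (norm (L ?z + c))\<^sup>2)
        + ereal (\<alpha> * m\<^sup>2 * (t * (1 - t)) * (norm (x - y))\<^sup>2)
      \<le> ereal (1 - t) * ereal (\<alpha> * (norm ?a)\<^sup>2) + ereal t * ereal (\<alpha> * (norm ?b)\<^sup>2)"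
    by simp
qed

section \<open>Minimization of strongly convex functions\<close>

text \<open>
  Fix \<open>x0\<close> with \<open>f x0 = a\<close> finite and a ball around it on which \<open>f > a - 1\<close>. For a point \<open>x\<close> at a large
  distance \<open>d\<close>, the segment from \<open>x0\<close> to \<open>x\<close> meets the sphere of radius \<open>\<rho>\<close> inside that ball. Convexity
  alone would allow \<open>f x\<close> to decrease linearly in \<open>d\<close>; the modulus contributes a term of order \<open>\<kappa> d\<^sup>2\<close>,
  which dominates.
\<close>

lemma strongly_convex_bounded_below:
  fixes f :: "'a::real_normed_vector \<Rightarrow> ereal"
  assumes proper: "proper_fun f" and lsc: "lsc_fun f"
    and sc: "strongly_convex_fun \<kappa> f" and "\<kappa> > 0"
  obtains B where "\<And>x. ereal B \<le> f x"
proof -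
  obtain x0 where "f x0 \<noteq> \<infinity>" "f x0 \<noteq> -\<infinity>"
    using proper unfolding proper_fun_def by blast
  then obtain a where a: "f x0 = ereal a"
    by (cases "f x0") auto
  then have "\<forall>\<^sub>F y in nhds x0. ereal (a - 1) < f y"
    using lsc unfolding lsc_fun_iff by simp
  then obtain r where "r > 0" and r: "\<And>y. dist y x0 < r \<Longrightarrow> ereal (a - 1) < f y"
    unfolding eventually_nhds_metric by blast
  define \<rho> where "\<rho> = r / 2"
  have "\<rho> > 0" using \<open>r > 0\<close> by (simp add: \<rho>_def)
  \<comment> \<open>The subtracted fraction is the maximum of \<open>d / \<rho> - \<kappa> d\<^sup>2 / 2\<close> over all \<open>d\<close>.\<close>
  define B where "B = a - 1 - 1 / (2 * \<kappa> * \<rho>\<^sup>2)"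
  have "B \<le> a - 1"
    using \<open>\<kappa> > 0\<close> \<open>\<rho> > 0\<close> by (simp add: B_def)
  have "ereal B \<le> f x" for x
  proof (cases "dist x x0 < r")
    case True
    then have "ereal (a - 1) < f x" by (rule r)
    then show ?thesis
      using \<open>B \<le> a - 1\<close> by (cases "f x") auto
  next
    case False
    define d where "d = norm (x0 - x)"
    have d: "d \<ge> 2 * \<rho>" using False by (simp add: d_def \<rho>_def dist_norm norm_minus_commute)
    with \<open>\<rho> > 0\<close> have "d > 0" by simp
    show ?thesis
    proof (cases "f x = \<infinity>")
      case False
      moreover have "f x \<noteq> -\<infinity>" using proper unfolding proper_fun_def by blast
      ultimately obtain b where b: "f x = ereal b" by (cases "f x") auto
      \<comment> \<open>With this weight the convex combination lies at distance \<open>\<rho>\<close> from \<open>x0\<close>; the choice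
        \<open>\<rho> = r / 2\<close> makes \<open>1 - t\<close> at least \<open>1/2\<close>.\<close>
      define t where "t = \<rho> / d"
      have t: "0 < t" "t \<le> 1/2" and td: "t * d = \<rho>"
        using \<open>\<rho> > 0\<close> \<open>d > 0\<close> d by (auto simp: t_def field_simps)
      let ?z = "(1 - t) *\<^sub>R x0 + t *\<^sub>R x"
      obtain c where c: "f ?z = ereal c"
        and cb: "c + \<kappa> * (t * (1 - t)) * (norm (x0 - x))\<^sup>2 \<le> (1 - t) * a + t * b"
        using strongly_convex_fun_finiteE[OF proper sc a b, of t] t by auto
      have "?z - x0 = t *\<^sub>R (x - x0)" by (simp add: algebra_simps)
      then have "dist ?z x0 = \<rho>"
        using t td by (simp add: dist_norm d_def norm_minus_commute)
      then have "a - 1 < c"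
        using r[of ?z] c \<open>r > 0\<close> by (simp add: \<rho>_def)
      moreover have "\<kappa> * (t * (1/2)) * d\<^sup>2 \<le> \<kappa> * (t * (1 - t)) * d\<^sup>2"
        using \<open>\<kappa> > 0\<close> t by (intro mult_left_mono mult_right_mono) auto
      ultimately have "t * (a - b + \<kappa> * d\<^sup>2 / 2) < 1"
        using cb by (simp add: d_def algebra_simps)
      then have "a - b + \<kappa> * d\<^sup>2 / 2 < 1 / t"
        using t by (simp add: field_simps)
      then have "a - b + \<kappa> * d\<^sup>2 / 2 < d / \<rho>"
        by (simp add: t_def)
      moreover have "\<kappa> * d\<^sup>2 / 2 - d / \<rho> + 1 / (2 * \<kappa> * \<rho>\<^sup>2) = \<kappa> / 2 * (d - 1 / (\<kappa> * \<rho>))\<^sup>2"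
        using \<open>\<kappa> > 0\<close> \<open>\<rho> > 0\<close> unfolding power2_diff
        by (simp add: power2_eq_square algebra_simps)
      moreover have "0 \<le> \<kappa> / 2 * (d - 1 / (\<kappa> * \<rho>))\<^sup>2"
        using \<open>\<kappa> > 0\<close> by simp
      ultimately have "B \<le> b"
        unfolding B_def by linarith
      then show ?thesis by (simp add: b)
    qed simp
  qed
  then show thesis by (rule that)
qed

text \<open>
  Two points whose values are within \<open>e\<close> of the infimum have a midpoint with value at least the infimum, so
  their distance is at most of order \<open>sqrt (e / \<kappa>)\<close>. This gives both the convergence of a minimizing
  sequence and, with \<open>e = 0\<close>, uniqueness.
\<close>

theorem strongly_convex_unique_minimizer:
  fixes f :: "'a::{real_normed_vector,complete_space} \<Rightarrow> ereal"
  assumes proper: "proper_fun f" and lsc: "lsc_fun f"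
    and sc: "strongly_convex_fun \<kappa> f" and "\<kappa> > 0"
  shows "\<exists>!u. is_arg_min f (\<lambda>_. True) u"
proof -
  obtain B where B: "\<And>x. ereal B \<le> f x"
    using strongly_convex_bounded_below assms by blast
  obtain x0 where x0: "f x0 \<noteq> \<infinity>"
    using proper unfolding proper_fun_def by blast
  define I where "I = (INF x. f x)"
  have "ereal B \<le> I" "I \<le> f x0"
    using B by (auto simp: I_def intro: INF_greatest INF_lower)
  then obtain m where m: "I = ereal m"
    using x0 by (cases I) auto
  have ge: "ereal m \<le> f x" for x
    unfolding m[symmetric] I_def by (rule INF_lower) simp
  have close: "\<kappa> / 4 * (norm (x - y))\<^sup>2 \<le> e"
    if x: "f x \<le> ereal (m + e)" and y: "f y \<le> ereal (m + e)" for x y e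
  proof -
    obtain a b where a: "f x = ereal a" and b: "f y = ereal b"
      using x y ge[of x] ge[of y] by (cases "f x"; cases "f y") auto
    obtain c where c: "f ((1 - 1/2) *\<^sub>R x + (1/2) *\<^sub>R y) = ereal c"
      "c + \<kappa> * (1/2 * (1 - 1/2)) * (norm (x - y))\<^sup>2 \<le> (1 - 1/2) * a + 1/2 * b"
      using strongly_convex_fun_finiteE[OF proper sc a b, of "1/2"] by auto
    have "m \<le> c" using ge c(1) by (metis ereal_less_eq(3))
    then show ?thesis using c(2) x y a b by simp
  qed
  have "\<exists>x. f x < ereal (m + 1 / Suc n)" for n
  proof -
    have "(INF x. f x) < ereal (m + 1 / Suc n)"
      using m unfolding I_def by simp
    then show ?thesis unfolding INF_less_iff by blast
  qed
  then obtain X where X: "\<And>n. f (X n) < ereal (m + 1 / Suc n)" by metis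
  have "Cauchy X"
  proof (rule metric_CauchyI)
    fix e :: real assume "e > 0"
    then have "0 < \<kappa> / 4 * e\<^sup>2"
      using \<open>\<kappa> > 0\<close> by simp
    then obtain N where N: "1 / Suc N < \<kappa> / 4 * e\<^sup>2"
      by (rule nat_approx_posE)
    have tail: "f (X n) \<le> ereal (m + 1 / Suc N)" if "n \<ge> N" for n
    proof -
      have "1 / real (Suc n) \<le> 1 / real (Suc N)" using that by (simp add: frac_le)
      then have "ereal (m + 1 / Suc n) \<le> ereal (m + 1 / Suc N)" by simp
      then show ?thesis by (rule order_trans[OF less_imp_le[OF X]])
    qed
    have "dist (X i) (X j) < e" if "i \<ge> N" "j \<ge> N" for i j
    proof -
      have "\<kappa> / 4 * (norm (X i - X j))\<^sup>2 \<le> 1 / Suc N"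
        by (rule close[OF tail[OF that(1)] tail[OF that(2)]])
      then have "\<kappa> / 4 * (norm (X i - X j))\<^sup>2 < \<kappa> / 4 * e\<^sup>2"
        using N by (rule le_less_trans)
      then have "(norm (X i - X j))\<^sup>2 < e\<^sup>2"
        by (rule mult_left_less_imp_less) (use \<open>\<kappa> > 0\<close> in simp)
      then show ?thesis
        unfolding dist_norm
        by (rule power_less_imp_less_base) (use \<open>e > 0\<close> in simp)
    qed
    then show "\<exists>M. \<forall>i\<ge>M. \<forall>j\<ge>M. dist (X i) (X j) < e" by blast
  qed
  then obtain u where u: "X \<longlonglongrightarrow> u"
    using Cauchy_convergent convergent_def by blast
  have fu: "f u = ereal m"
  proof (rule antisym)
    show "f u \<le> ereal m"
    proof (rule ccontr)
      assume "\<not> f u \<le> ereal m"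
      then have "ereal m < f u" by simp
      then obtain a where a: "ereal m < ereal a" "ereal a < f u"
        using ereal_dense2[of "ereal m" "f u"] by auto
      then have "\<forall>\<^sub>F y in nhds u. ereal a < f y"
        using lsc unfolding lsc_fun_iff by blast
      then have "\<forall>\<^sub>F n in sequentially. ereal a < f (X n)"
        using u unfolding filterlim_iff by blast
      then have "\<forall>\<^sub>F n in sequentially. a - m \<le> 1 / Suc n"
      proof eventually_elim
        case (elim n)
        then have "ereal a < ereal (m + 1 / Suc n)" using X by (rule less_trans)
        then show ?case by simp
      qed
      moreover have "(\<lambda>n. 1 / real (Suc n)) \<longlonglongrightarrow> 0"
        using LIMSEQ_inverse_real_of_nat by (simp add: inverse_eq_divide)
      ultimately have "a - m \<le> 0"
        by (intro tendsto_lowerbound[of _ _ sequentially]) auto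
      then show False using a by simp
    qed
  qed (rule ge)
  show ?thesis
  proof (rule ex1I[of _ u])
    show "is_arg_min f (\<lambda>_. True) u"
      using ge by (auto simp: is_arg_min_def fu not_less)
  next
    fix v assume "is_arg_min f (\<lambda>_. True) v"
    then have "f v \<le> f u"
      by (auto simp: is_arg_min_def not_less)
    then have "\<kappa> / 4 * (norm (v - u))\<^sup>2 \<le> 0"
      using fu by (intro close) auto
    then show "v = u" using \<open>\<kappa> > 0\<close> by (simp add: mult_le_0_iff)
  qed
qed

corollary convex_plus_norm_sq_unique_minimizer:
  fixes g :: "'a::{real_normed_vector,complete_space} \<Rightarrow> ereal" and L :: "'a \<Rightarrow> 'b::real_inner"
  assumes g: "proper_fun g" "convex_fun g" "lsc_fun g"
    and L: "bounded_linear L" and below: "\<And>u. m * norm u \<le> norm (L u)"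
    and "m > 0" "\<alpha> > 0"
  shows "\<exists>!u. is_arg_min (\<lambda>u. g u + ereal (\<alpha> * (norm (L u + c))\<^sup>2)) (\<lambda>_. True) u"
proof (rule strongly_convex_unique_minimizer)
  have "continuous_on UNIV (\<lambda>u. \<alpha> * (norm (L u + c))\<^sup>2)"
    by (intro continuous_intros bounded_linear.continuous_on[OF L])
  then show "lsc_fun (\<lambda>u. g u + ereal (\<alpha> * (norm (L u + c))\<^sup>2))"
    by (rule lsc_fun_add_continuous[OF g(3)])
  show "strongly_convex_fun (\<alpha> * m\<^sup>2) (\<lambda>u. g u + ereal (\<alpha> * (norm (L u + c))\<^sup>2))"
    using g \<open>m > 0\<close> \<open>\<alpha> > 0\<close> below bounded_linear.linear[OF L]
    by (intro strongly_convex_fun_add strongly_convex_affine_norm_sq) (auto simp: proper_fun_def)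
  show "proper_fun (\<lambda>u. g u + ereal (\<alpha> * (norm (L u + c))\<^sup>2))"
    using g(1) by (auto simp: proper_fun_def)
  show "0 < \<alpha> * m\<^sup>2" using \<open>m > 0\<close> \<open>\<alpha> > 0\<close> by simp
qed

section \<open>Adjoints on Hilbert spaces\<close>

text \<open>
  The minimizer \<open>w\<close> of \<open>\<parallel>u\<parallel>\<^sup>2 / 2 - f u\<close> represents \<open>f\<close>, because the first variation there,
  \<open>\<langle>x, w\<rangle> - f x\<close>, vanishes in every direction \<open>x\<close>.
\<close>

theorem riesz_representation:
  fixes f :: "'a::{real_inner,complete_space} \<Rightarrow> real"
  assumes "bounded_linear f"
  obtains w where "\<And>x. f x = inner x w"
proof -
  interpret f: bounded_linear f by fact
  let ?F = "\<lambda>u. ereal (- f u) + ereal (1/2 * (norm (u + 0))\<^sup>2)"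
  \<comment> \<open>The summands \<open>0\<close> here and in \<open>?F\<close> match the general lemmas with \<open>g = 0\<close> and \<open>c = 0\<close>.\<close>
  have "lsc_fun (\<lambda>u. 0 + ereal (- f u))"
    by (intro lsc_fun_add_continuous continuous_intros f.continuous_on)
       (simp add: lsc_fun_iff)
  then have "\<exists>!u. is_arg_min ?F (\<lambda>_. True) u"
    by (intro convex_plus_norm_sq_unique_minimizer[where m = 1])
       (auto simp: proper_fun_def convex_fun_def f.add f.scaleR bounded_linear_ident)
  then obtain w where w: "is_arg_min ?F (\<lambda>_. True) w" by blast
  have min: "1/2 * (norm w)\<^sup>2 - f w \<le> 1/2 * (norm v)\<^sup>2 - f v" for v
    using w by (auto simp: is_arg_min_def not_less)
  have "f x = inner x w" for x
  proof (cases "x = 0")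
    case False
    define \<delta> where "\<delta> = inner x w - f x"
    \<comment> \<open>The step that minimizes the quadratic \<open>s \<delta> + s\<^sup>2 \<parallel>x\<parallel>\<^sup>2 / 2\<close>.\<close>
    define s where "s = - \<delta> / (norm x)\<^sup>2"
    have "0 \<le> s * \<delta> + s\<^sup>2 * (norm x)\<^sup>2 / 2"
      using min[of "w + s *\<^sub>R x"] unfolding power2_norm_eq_inner \<delta>_def
      by (simp add: f.add f.scaleR algebra_simps inner_commute power2_eq_square)
    also have "\<dots> = - \<delta>\<^sup>2 / (2 * (norm x)\<^sup>2)"
      using False by (simp add: s_def field_simps power2_eq_square)
    finally have "\<delta> = 0"
      using False by (simp add: divide_le_0_iff)
    then show ?thesis by (simp add: \<delta>_def)
  qed simp
  then show thesis by (rule that)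
qed

lemma inner_adjoint:
  fixes L :: "'a::{real_inner,complete_space} \<Rightarrow> 'b::real_inner"
  assumes "bounded_linear L"
  shows "inner (L x) y = inner x (adjoint L y)"
proof -
  have "\<exists>w. \<forall>x. inner (L x) y = inner x w" for y
    using riesz_representation[OF bounded_linear_compose[OF bounded_linear_inner_left assms]]
    by metis
  then obtain L' where "\<forall>x y. inner (L x) y = inner x (L' y)" by metis
  moreover from this have "adjoint L = L'" by (rule adjoint_unique)
  ultimately show ?thesis by simp
qed

section \<open>Boundedness below\<close>

text \<open>
  This is the uniform boundedness principle for the functionals \<open>\<lambda>y. \<langle>u, y\<rangle>\<close> with \<open>u \<in> S\<close>. The closed sets
  \<open>F n\<close> on which all of them are bounded by \<open>n\<close> cover the space, so one of them contains a ball; moving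
  from its centre in the direction of \<open>u\<close> bounds \<open>\<parallel>u\<parallel>\<close>.
\<close>

lemma weakly_bounded_imp_bounded:
  fixes S :: "'a::{real_inner,complete_space} set"
  assumes weak: "\<And>y. \<exists>C. \<forall>u\<in>S. \<bar>inner u y\<bar> \<le> C"
  shows "bounded S"
proof -
  define F where "F n = {y. \<forall>u\<in>S. \<bar>inner u y\<bar> \<le> real n}" for n :: nat
  have closed: "closed (F n)" for n
  proof -
    have "F n = (\<Inter>u\<in>S. {y. \<bar>inner u y\<bar> \<le> real n})" by (auto simp: F_def)
    then show ?thesis
      by (auto intro!: closed_INT closed_Collect_le continuous_intros)
  qed
  have "y \<in> (\<Union>n. F n)" for y
  proof -
    obtain C where C: "\<forall>u\<in>S. \<bar>inner u y\<bar> \<le> C" using weak by blast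
    obtain n where "C \<le> real n" using real_arch_simple by blast
    with C have "y \<in> F n" by (force simp: F_def)
    then show ?thesis by blast
  qed
  then have cover: "(\<Union>n. F n) = UNIV" by blast
  have "\<exists>n. interior (F n) \<noteq> {}"
  proof (rule ccontr)
    assume "\<nexists>n. interior (F n) \<noteq> {}"
    then have "Met_TC.mtopology interior_of (\<Union>(range F)) = {}"
      using closed by (intro Met_TC.metric_Baire_category_alt) (auto simp: complete_UNIV)
    then show False by (simp add: cover)
  qed
  then obtain n y0 r where "r > 0" and r: "ball y0 r \<subseteq> F n"
    by (meson ex_in_conv mem_interior)
  have "norm u \<le> 4 * n / r" if "u \<in> S" for u
  proof (cases "u = 0")
    case False
    define y where "y = y0 + (r / (2 * norm u)) *\<^sub>R u"
    have "dist y0 y < r"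
      using False \<open>r > 0\<close> by (simp add: y_def dist_norm)
    then have "y \<in> F n" "y0 \<in> F n"
      using r \<open>r > 0\<close> by auto
    then have "\<bar>inner u y\<bar> \<le> n" "\<bar>inner u y0\<bar> \<le> n"
      using that by (auto simp: F_def)
    moreover have "inner u y = inner u y0 + r / 2 * norm u"
      using False by (simp add: y_def inner_add_right flip: power2_norm_eq_inner)
         (simp add: power2_eq_square)
    ultimately have "r / 2 * norm u \<le> 2 * n" by linarith
    then show ?thesis using \<open>r > 0\<close> by (simp add: field_simps)
  qed (use \<open>r > 0\<close> in simp)
  then show ?thesis by (auto simp: bounded_iff)
qed

text \<open>
  By surjectivity every functional \<open>\<langle>-, y\<rangle>\<close> factors through \<open>L\<close>, as \<open>u \<mapsto> \<langle>L u, L v\<rangle>\<close>, so it is bounded on the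
  set where \<open>\<parallel>L u\<parallel> \<le> 1\<close>.
\<close>

lemma surj_adjoint_comp_imp_bounded_below:
  fixes L :: "'a::{real_inner,complete_space} \<Rightarrow> 'b::real_inner"
  assumes L: "bounded_linear L" and surj: "surj (adjoint L \<circ> L)"
  obtains m where "m > 0" "\<And>u. m * norm u \<le> norm (L u)"
proof -
  interpret L: bounded_linear L by fact
  have "bounded {u. norm (L u) \<le> 1}"
  proof (rule weakly_bounded_imp_bounded)
    fix y
    obtain v where v: "y = adjoint L (L v)"
      using surj by (metis comp_apply surjD)
    have "\<bar>inner u y\<bar> \<le> norm (L v)" if "norm (L u) \<le> 1" for u
    proof -
      have "\<bar>inner u y\<bar> = \<bar>inner (L u) (L v)\<bar>"
        unfolding v inner_adjoint[OF L] ..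
      also have "\<dots> \<le> norm (L u) * norm (L v)"
        by (rule Cauchy_Schwarz_ineq2)
      also have "\<dots> \<le> norm (L v)"
        using that by (simp add: mult_left_le_one_le)
      finally show ?thesis .
    qed
    then show "\<exists>C. \<forall>u\<in>{u. norm (L u) \<le> 1}. \<bar>inner u y\<bar> \<le> C" by blast
  qed
  then obtain M where "M > 0" and M: "\<And>u. norm (L u) \<le> 1 \<Longrightarrow> norm u \<le> M"
    unfolding bounded_pos by blast
  have "norm u \<le> M * norm (L u)" for u
  proof (cases "L u = 0")
    case True
    \<comment> \<open>A nonzero \<open>u\<close> in the kernel could be scaled to norm \<open>M + 1\<close>, inside a set bounded by \<open>M\<close>.\<close>
    have "norm (((M + 1) / norm u) *\<^sub>R u) \<le> M"
      using True by (intro M) (simp add: L.scaleR)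
    then show ?thesis using \<open>M > 0\<close> True by (cases "u = 0") auto
  next
    case False
    have "norm ((1 / norm (L u)) *\<^sub>R u) \<le> M"
      using False by (intro M) (simp add: L.scaleR)
    then show ?thesis using False by (simp add: field_simps)
  qed
  then have "1 / M * norm u \<le> norm (L u)" for u
    using \<open>M > 0\<close> by (simp add: field_simps)
  then show thesis using \<open>M > 0\<close> by (intro that[of "1 / M"]) auto
qed

section \<open>Existence and uniqueness of the minimizer\<close>

theorem proposition1p1:
  fixes g :: "'a::{real_inner,complete_space} \<Rightarrow> ereal"
    and L :: "'a \<Rightarrow> 'b::{real_inner,complete_space}"
    and lambda :: real
    and c :: 'b
  assumes "proper_fun g" and "convex_fun g" and "lsc_fun g"
    and "bounded_linear L"
    and "lambda > 0"
    and "surj (adjoint L \<circ> L)"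
  shows "\<exists>!u. is_arg_min (\<lambda>u. g u + ereal (lambda / 2 * (norm (L u + c))\<^sup>2)) (\<lambda>_. True) u"
proof -
  obtain m where "m > 0" "\<And>u. m * norm u \<le> norm (L u)"
    using surj_adjoint_comp_imp_bounded_below assms by blast
  then show ?thesis
    using assms by (intro convex_plus_norm_sq_unique_minimizer[where m = m]) auto
qed

end
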